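(* Let $n\ge 1$, let $X_1,\dots,X_n$ be independent real random variables, and let $S:\mathbb{R}^n\to\mathbb{R}$ be a Borel function with $\mathbb{E}\,S^2(X_1,\dots,X_n)<+\infty$; write $S$ for $S(X_1,\dots,X_n)$. Let $J_k$, $1\le k\le n$, be the iterated jackknives of $S$. Then for every $p=1,2,\dots,[n/2]$ (where $[\cdot]$ denotes integer part), $$\sum_{k=1}^{2p}\frac{(-1)^{k+1}}{k!}\,\mathbb{E}J_k\;\le\;\operatorname{Var} S\;\le\;\sum_{k=1}^{2p-1}\frac{(-1)^{k+1}}{k!}\,\mathbb{E}J_k,$$ and $$\operatorname{Var} S=\sum_{k=1}^{n}\frac{(-1)^{k+1}}{k!}\,\mathbb{E}J_k .$$
   Context: The $X_i$ are not assumed identically distributed and $S$ is not assumed symmetric. Let $\mu_i$ be the law of $X_i$. In what follows $Y$ denotes any square-integrable random variable of the form $Y=g(X_1,\dots,X_n)$ with $g$ Borel. For $i\in\{1,\dots,n\}$, $\mathbb{E}^{(i)}$ is conditional expectation given $X_1,\dots,X_{i-1},X_{i+1},\dots,X_n$, i.e. $$\mathbb{E}^{(i)}Y=\int g(X_1,\dots,X_{i-1},x_i,X_{i+1},\dots,X_n)\,\mu_i(dx_i).$$ These operators commute. Iterated conditional variances: $\operatorname{Var}^{(i)}Y:=\mathbb{E}^{(i)}(Y-\mathbb{E}^{(i)}Y)^2=\mathbb{E}^{(i)}Y^2-(\mathbb{E}^{(i)}Y)^2$, and recursively, for distinct indices $i_1,\dots,i_k\in\{1,\dots,n\}$, $k\ge2$,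 $$\operatorname{Var}^{(i_1,\dots,i_k)}Y:=\mathbb{E}^{(i_1)}\big(\operatorname{Var}^{(i_2,\dots,i_k)}Y\big)-\operatorname{Var}^{(i_2,\dots,i_k)}\big(\mathbb{E}^{(i_1)}Y\big).$$ The result does not depend on the order of the indices. (For $k\ge2$ this is not the usual conditional variance.) Iterated jackknives: for $1\le k\le n$, $$J_k:=k!\sum_{1\le i_1<i_2<\cdots<i_k\le n}\operatorname{Var}^{(i_1,\dots,i_k)}S .$$ *)

theory Defs
  imports "HOL-Probability.Probability"
begin

text \<open>
  A random variable \<open>Y = g(X\<^sub>1, \<dots>, X\<^sub>n)\<close> is represented by the function \<open>g\<close>, where a point of
  the space of \<open>n\<close>-tuples of reals is an extensional function on \<open>{1..n}\<close>, that is, an element of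
  \<open>space (PiM {1..n} (\<lambda>_. borel))\<close>. The random variable itself is \<open>\<lambda>\<omega>. g (sample X n \<omega>)\<close>.
\<close>

definition sample :: "(nat \<Rightarrow> 'a \<Rightarrow> real) \<Rightarrow> nat \<Rightarrow> 'a \<Rightarrow> (nat \<Rightarrow> real)" where
  "sample X n \<omega> = (\<lambda>i\<in>{1..n}. X i \<omega>)"

definition laws :: "'a measure \<Rightarrow> (nat \<Rightarrow> 'a \<Rightarrow> real) \<Rightarrow> nat \<Rightarrow> real measure" where
  "laws M X i = distr M borel (X i)"

text \<open>
  \<open>cexp \<mu> i\<close> integrates out the \<open>i\<close>-th coordinate. The lemma \<open>real_cond_exp_sample\<close> below confirms
  that, for independent \<open>X\<^sub>j\<close>, this is the conditional expectation given all \<open>X\<^sub>j\<close> with \<open>j \<noteq> i\<close>.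
\<close>

definition cexp :: "(nat \<Rightarrow> real measure) \<Rightarrow> nat \<Rightarrow> ((nat \<Rightarrow> real) \<Rightarrow> real) \<Rightarrow> (nat \<Rightarrow> real) \<Rightarrow> real" where
  "cexp \<mu> i g x = (\<integral>t. g (x(i := t)) \<partial>\<mu> i)"

text \<open>
  The index list is meant to be nonempty and distinct; the value for \<open>[]\<close> is an arbitrary
  placeholder and is never reached from a nonempty list.
\<close>

fun cvar :: "(nat \<Rightarrow> real measure) \<Rightarrow> nat list \<Rightarrow> ((nat \<Rightarrow> real) \<Rightarrow> real) \<Rightarrow> (nat \<Rightarrow> real) \<Rightarrow> real" where
  "cvar \<mu> [] g = (\<lambda>x. 0)"
| "cvar \<mu> [i] g = cexp \<mu> i (\<lambda>x. (g x - cexp \<mu> i g x)\<^sup>2)"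
| "cvar \<mu> (i # j # js) g =
     (\<lambda>x. cexp \<mu> i (cvar \<mu> (j # js) g) x - cvar \<mu> (j # js) (cexp \<mu> i g) x)"

definition index_tuples :: "nat \<Rightarrow> nat \<Rightarrow> nat list set" where
  "index_tuples n k = {js. length js = k \<and> sorted_wrt (<) js \<and> set js \<subseteq> {1..n}}"

definition jackknife ::
    "(nat \<Rightarrow> real measure) \<Rightarrow> nat \<Rightarrow> nat \<Rightarrow> ((nat \<Rightarrow> real) \<Rightarrow> real) \<Rightarrow> (nat \<Rightarrow> real) \<Rightarrow> real" where
  "jackknife \<mu> n k g x = fact k * (\<Sum>js\<in>index_tuples n k. cvar \<mu> js g x)"

text \<open>The sum in \<open>jackknife\<close> is over a finite set, so it does not default to \<open>0\<close>.\<close>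

lemma finite_index_tuples: "finite (index_tuples n k)"
  by (rule finite_subset[OF _ finite_lists_length_eq[of "{1..n}" k]])
     (auto simp: index_tuples_def)

lemma (in prob_space) real_cond_exp_sample:
  fixes X :: "nat \<Rightarrow> 'a \<Rightarrow> real"
  assumes i: "i \<in> {1..n}"
    and indep: "indep_vars (\<lambda>_. borel) X {1..n}"
    and g: "g \<in> borel_measurable (PiM {1..n} (\<lambda>_. borel))"
    and int: "integrable M (\<lambda>\<omega>. g (sample X n \<omega>))"
  defines "F \<equiv> vimage_algebra (space M) (\<lambda>\<omega>. \<lambda>j\<in>{1..n} - {i}. X j \<omega>)
                 (PiM ({1..n} - {i}) (\<lambda>_. borel))"
  shows "AE \<omega> in M. real_cond_exp M F (\<lambda>\<omega>. g (sample X n \<omega>)) \<omega> =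
                    cexp (laws M X) i g (sample X n \<omega>)"
proof -
  define I where "I = {1..n}"
  define K where "K = I - {i}"
  define N where "N j = (if j \<in> I then laws M X j else return borel 0)" for j
  have IK: "I = insert i K" "i \<notin> K" "finite K" "finite I" "K \<subseteq> I" "i \<in> I"
    using i by (auto simp: I_def K_def)
  have Xm[measurable]: "random_variable borel (X j)" if "j \<in> I" for j
    using indep that by (auto simp: indep_vars_def I_def)
  have sN[measurable_cong]: "sets (N j) = sets borel" for j
    by (auto simp: N_def laws_def)
  have pN: "prob_space (N j)" for j
    using Xm by (auto simp: N_def laws_def intro!: prob_space_distr prob_space_return)
  interpret NP: product_prob_space N "UNIV"
    using pN by (auto simp: product_prob_space_def product_prob_space_axioms_def product_sigma_finite_def
        intro: prob_space_imp_sigma_finite)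
  have sP: "sets (PiM J N) = sets (PiM J (\<lambda>_. borel))" for J
    by (intro sets_PiM_cong refl sN)
  have smp: "sample X n = (\<lambda>\<omega>. \<lambda>j\<in>I. X j \<omega>)"
    by (simp add: sample_def I_def fun_eq_iff)
  have sm[measurable]: "sample X n \<in> M \<rightarrow>\<^sub>M PiM I (\<lambda>_. borel)"
    unfolding smp by (intro measurable_restrict Xm)
  have smP: "sample X n \<in> M \<rightarrow>\<^sub>M PiM I N"
    using sm by (simp add: measurable_cong_sets[OF refl sP])
  have "distr M (PiM I (\<lambda>_. borel)) (sample X n) = PiM I (\<lambda>j. distr M borel (X j))"
    using indep_vars_iff_distr_eq_PiM'[where I=I and M'="\<lambda>_. borel" and X=X] indep Xm IK(6)
    unfolding smp I_def[symmetric] by blast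
  also have "\<dots> = PiM I N"
    by (intro PiM_cong refl) (simp add: N_def laws_def)
  also have "distr M (PiM I (\<lambda>_. borel)) (sample X n) = distr M (PiM I N) (sample X n)"
    by (intro distr_cong refl) (simp add: sP)
  finally have D: "distr M (PiM I N) (sample X n) = PiM I N" .
  have gI: "g \<in> borel_measurable (PiM I N)"
    using g by (simp add: measurable_cong_sets[OF sP refl] I_def)
  have gint: "integrable (PiM I N) g"
    using int integrable_distr_eq[OF smP gI] by (simp add: D)
  define h where "h x = (\<integral>t. g (x(i := t)) \<partial>N i)" for x
  have hc: "cexp (laws M X) i g = h"
    by (auto simp: fun_eq_iff cexp_def h_def N_def IK)
  interpret Ni: prob_space "N i" by (rule pN)
  have upd: "(\<lambda>(x, t). x(i := t)) \<in> PiM K N \<Otimes>\<^sub>M N i \<rightarrow>\<^sub>M PiM I N"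
    unfolding IK(1) by (rule measurable_add_dim)
  have gu: "(\<lambda>(x, t). g (x(i := t))) \<in> borel_measurable (PiM K N \<Otimes>\<^sub>M N i)"
    using measurable_comp[OF upd gI] by (simp add: comp_def split_beta')
  have hm: "h \<in> borel_measurable (PiM K N)"
    unfolding h_def using gu by measurable
  have hint: "integrable (PiM K N) h"
  proof (rule integrableI_bounded[OF hm])
    have "(\<integral>\<^sup>+x. norm (h x) \<partial>PiM K N) \<le> (\<integral>\<^sup>+x. (\<integral>\<^sup>+t. norm (g (x(i := t))) \<partial>N i) \<partial>PiM K N)"
      unfolding h_def
    proof (intro nn_integral_mono)
      fix x
      show "ennreal (norm (\<integral>t. g (x(i := t)) \<partial>N i)) \<le> (\<integral>\<^sup>+t. norm (g (x(i := t))) \<partial>N i)"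
        by (cases "integrable (N i) (\<lambda>t. g (x(i := t)))")
           (use integral_norm_bound_ennreal in \<open>force simp: not_integrable_integral_eq\<close>)+
    qed
    also have "\<dots> = (\<integral>\<^sup>+x. norm (g x) \<partial>PiM I N)"
      unfolding IK(1) using gI IK by (intro NP.product_nn_integral_insert[symmetric]) auto
    also have "\<dots> < \<infinity>" using gint by (simp add: integrable_iff_bounded)
    finally show "(\<integral>\<^sup>+x. norm (h x) \<partial>PiM K N) < \<infinity>" .
  qed
  define r where "r = (\<lambda>x :: nat \<Rightarrow> real. restrict x K)"
  have r: "r \<in> PiM I N \<rightarrow>\<^sub>M PiM K N"
    unfolding r_def by (rule measurable_restrict_subset[OF IK(5)])
  have rD: "PiM K N = distr (PiM I N) (PiM K N) r"
    unfolding r_def by (rule NP.distr_restrict[OF IK(5,4)])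
  have rs: "(\<lambda>\<omega>. \<lambda>j\<in>K. X j \<omega>) = (\<lambda>\<omega>. r (sample X n \<omega>))"
    using IK(5) by (auto simp: r_def smp fun_eq_iff restrict_def)
  have rsm: "(\<lambda>\<omega>. r (sample X n \<omega>)) \<in> M \<rightarrow>\<^sub>M PiM K N"
    using measurable_comp[OF smP r] by (simp add: comp_def)
  have rsm': "(\<lambda>\<omega>. r (sample X n \<omega>)) \<in> M \<rightarrow>\<^sub>M PiM K (\<lambda>_. borel)"
    using rsm by (simp add: measurable_cong_sets[OF refl sP])
  have F: "F = vimage_algebra (space M) (\<lambda>\<omega>. r (sample X n \<omega>)) (PiM K (\<lambda>_. borel))"
    unfolding F_def rs[symmetric] K_def I_def ..
  have subF: "subalgebra M F"
    unfolding subalgebra_def F using rsm' by (auto simp: sets_image_in_sets)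
  have hr: "h (sample X n \<omega>) = h (r (sample X n \<omega>))" for \<omega>
  proof -
    have "(sample X n \<omega>)(i := t) = (r (sample X n \<omega>))(i := t)" for t
      by (auto simp: fun_eq_iff r_def smp K_def)
    then show ?thesis by (simp add: h_def)
  qed
  have D2: "distr M (PiM K N) (\<lambda>\<omega>. r (sample X n \<omega>)) = PiM K N"
    using distr_distr[OF r smP] rD by (simp add: D comp_def)
  have hsi: "integrable M (\<lambda>\<omega>. h (sample X n \<omega>))"
    using integrable_distr_eq[OF rsm hm] hint by (simp add: D2 hr)
  interpret sf: sigma_finite_subalgebra M F
    by (intro finite_measure_subalgebra_is_sigma_finite finite_measure_subalgebra.intro
        finite_measure_subalgebra_axioms.intro subF finite_measure_axioms)
  show ?thesis
    unfolding hc
  proof (rule sf.real_cond_exp_charact[OF _ int hsi])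
    have hm': "h \<in> borel_measurable (PiM K (\<lambda>_. borel))"
      using hm by (simp add: measurable_cong_sets[OF sP refl])
    have "(\<lambda>\<omega>. r (sample X n \<omega>)) \<in> F \<rightarrow>\<^sub>M PiM K (\<lambda>_. borel)"
      unfolding F by (rule measurable_vimage_algebra1) (use measurable_space[OF rsm'] in auto)
    from measurable_comp[OF this hm']
    show "(\<lambda>\<omega>. h (sample X n \<omega>)) \<in> borel_measurable F"
      by (simp add: comp_def hr)
  next
    fix A assume "A \<in> sets F"
    then obtain B where B: "B \<in> sets (PiM K N)"
      and A: "A = (\<lambda>\<omega>. r (sample X n \<omega>)) -` B \<inter> space M"
      unfolding F using measurable_space[OF rsm']
      by (subst (asm) sets_vimage_algebra2) (auto simp: sP)
    have iB: "indicator B \<in> borel_measurable (PiM K N)" using B by simp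
    have iBr: "(\<lambda>x. indicator B (r x) :: real) \<in> borel_measurable (PiM I N)"
      using measurable_comp[OF r iB] by (simp add: comp_def)
    have gi: "integrable (PiM I N) (\<lambda>x. indicator B (r x) * g x)"
      by (rule Bochner_Integration.integrable_bound[OF gint])
         (use iBr gI in \<open>auto simp: indicator_def\<close>)
    have "(\<integral>\<omega>\<in>A. g (sample X n \<omega>) \<partial>M) = (\<integral>\<omega>. indicator B (r (sample X n \<omega>)) * g (sample X n \<omega>) \<partial>M)"
      unfolding set_lebesgue_integral_def
      by (intro Bochner_Integration.integral_cong) (auto simp: A indicator_def)
    also have "\<dots> = (\<integral>x. indicator B (r x) * g x \<partial>PiM I N)"
      using integral_distr[OF smP, of "\<lambda>x. indicator B (r x) * g x"] gi by (simp add: D)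
    also have "\<dots> = (\<integral>x. (\<integral>t. indicator B (r (x(i := t))) * g (x(i := t)) \<partial>N i) \<partial>PiM K N)"
      using gi IK unfolding IK(1) by (intro NP.product_integral_insert) auto
    also have "\<dots> = (\<integral>x. indicator B x * h x \<partial>PiM K N)"
    proof (intro Bochner_Integration.integral_cong refl)
      fix x assume "x \<in> space (PiM K N)"
      then have "r (x(i := t)) = x" for t
        using IK(2) by (auto simp: r_def space_PiM PiE_def extensional_def fun_eq_iff restrict_def)
      then show "(\<integral>t. indicator B (r (x(i := t))) * g (x(i := t)) \<partial>N i) = indicator B x * h x"
        by (simp add: h_def)
    qed
    also have "\<dots> = (\<integral>\<omega>. indicator B (r (sample X n \<omega>)) * h (r (sample X n \<omega>)) \<partial>M)"
      using integral_distr[OF rsm, of "\<lambda>x. indicator B x * h x"] borel_measurable_times[OF iB hm]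
      by (simp add: D2)
    also have "\<dots> = (\<integral>\<omega>\<in>A. h (sample X n \<omega>) \<partial>M)"
      unfolding set_lebesgue_integral_def
      by (intro Bochner_Integration.integral_cong) (auto simp: A hr indicator_def)
    finally show "(\<integral>\<omega>\<in>A. g (sample X n \<omega>) \<partial>M) = (\<integral>\<omega>\<in>A. h (sample X n \<omega>) \<partial>M)" .
  qed
qed

end

theory Submission
  imports Defs
begin

text \<open>
  Write \<open>E\<^sub>i\<close> for \<open>cexp \<mu> i\<close>. The \<open>E\<^sub>i\<close> are commuting orthogonal projections of \<open>L\<^sup>2\<close>, so by
  induction on the index list the integral of an iterated conditional variance is
  \<open>\<E> Var\<^bsup>(A)\<^esup> Y = \<parallel>\<Prod>\<^bsub>i\<in>A\<^esub> (1 - E\<^sub>i) Y\<parallel>\<^sup>2\<close>.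
  With \<open>s\<^sub>J(k, Y)\<close> the sum of these over the \<open>k\<close>-subsets \<open>A\<close> of \<open>J\<close> and
  \<open>F\<^sub>J(m, Y) = \<Sum>\<^bsub>k\<le>m\<^esub> (-1)\<^sup>k s\<^sub>J(k, Y)\<close>, splitting off one index gives
  \<open>F\<^bsub>J\<union>{i}\<^esub>(m, Y) = F\<^sub>J(m, E\<^sub>i Y) + (-1)\<^sup>m (s\<^sub>J(m, Y) - s\<^sub>J(m, E\<^sub>i Y))\<close>, where the last bracket is
  nonnegative, and empty once \<open>m\<close> exceeds the size of \<open>J\<close>. Removing all indices shows that
  \<open>(-1)\<^sup>m (F(m, S) - (\<E> S)\<^sup>2) \<ge> 0\<close>, which is the claim because \<open>s(0, S) = \<E> S\<^sup>2\<close>.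
\<close>

section \<open>Integrating out coordinates\<close>

lemma (in prob_space) expectation_square_le:
  fixes f :: "'a \<Rightarrow> real"
  assumes "integrable M (\<lambda>x. (f x)\<^sup>2)" and "f \<in> borel_measurable M"
  shows "(expectation f)\<^sup>2 \<le> expectation (\<lambda>x. (f x)\<^sup>2)"
  using variance_positive[of f] variance_eq[OF square_integrable_imp_integrable[OF assms(2,1)] assms(1)]
  by simp

lemma cexp_eqI:
  assumes "\<And>t. f (x(i := t)) = g (y(i := t))"
  shows "cexp \<mu> i f x = cexp \<mu> i g y"
  by (simp add: cexp_def assms)

lemma cexp_upd [simp]: "cexp \<mu> i g (x(i := t)) = cexp \<mu> i g x"
  by (simp add: cexp_def)

text \<open>\<open>cexp \<mu> i g\<close> does not vary with coordinate \<open>i\<close>, so it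
  leaves the integral as a constant. This is the pull-out property of conditional expectation, here
  at every point.\<close>

lemma cexp_mult_cexp: "cexp \<mu> i (\<lambda>x. f x * cexp \<mu> i g x) x = cexp \<mu> i f x * cexp \<mu> i g x"
  by (simp only: cexp_def fun_upd_upd) simp

text \<open>The product of the operators \<open>1 - E_i\<close> along the list, with the head as the
  outermost factor.\<close>

fun cdiff :: "(nat \<Rightarrow> real measure) \<Rightarrow> nat list \<Rightarrow> ((nat \<Rightarrow> real) \<Rightarrow> real) \<Rightarrow> (nat \<Rightarrow> real) \<Rightarrow> real" where
  "cdiff \<mu> [] g = g"
| "cdiff \<mu> (i # js) g = (\<lambda>x. cdiff \<mu> js g x - cexp \<mu> i (cdiff \<mu> js g) x)"

locale real_product_prob_space = finite_product_prob_space \<mu> I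
  for \<mu> :: "nat \<Rightarrow> real measure" and I :: "nat set"
begin

abbreviation "P \<equiv> PiM I \<mu>"

section \<open>Resampling one coordinate of a product space\<close>

lemma measurable_upd [measurable]:
  assumes "i \<in> I" shows "(\<lambda>(x, t). x(i := t)) \<in> P \<Otimes>\<^sub>M \<mu> i \<rightarrow>\<^sub>M P"
  unfolding split_beta' by (intro measurable_fun_upd[where J=I] measurable_snd measurable_fst) (use assms in auto)

text \<open>Replacing one coordinate by an independent copy preserves the product law. Hence every
  \<open>cexp \<mu> i\<close> can be treated as an operator on functions over the one space
  \<open>P\<close>, without splitting off a coordinate. The law is identified by its values on
  boxes.\<close>

lemma distr_upd:
  assumes i: "i \<in> I"
  shows "distr (P \<Otimes>\<^sub>M \<mu> i) P (\<lambda>(x, t). x(i := t)) = P"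
proof (rule PiM_eqI)
  interpret Pi: pair_sigma_finite P "\<mu> i" ..
  fix A assume A: "\<And>j. j \<in> I \<Longrightarrow> A j \<in> sets (\<mu> j)"
  \<comment> \<open>\<open>?B\<close> drops the constraint on coordinate \<open>i\<close>: on the
    space, \<open>x(i := t)\<close> lies in the box of \<open>A\<close> exactly if \<open>x\<close>
    lies in the box of \<open>?B\<close> and \<open>t\<close> in \<open>A i\<close>.\<close>
  let ?B = "A(i := space (\<mu> i))"
  have B: "?B j \<in> sets (\<mu> j)" if "j \<in> I" for j using A that by auto
  have PA: "Pi\<^sub>E I A \<in> sets P" using A finite_index by (intro sets_PiM_I_finite) auto
  have "emeasure (distr (P \<Otimes>\<^sub>M \<mu> i) P (\<lambda>(x, t). x(i := t))) (Pi\<^sub>E I A)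
     = emeasure (P \<Otimes>\<^sub>M \<mu> i) (((\<lambda>(x, t). x(i := t)) -` Pi\<^sub>E I A) \<inter> space (P \<Otimes>\<^sub>M \<mu> i))"
    using PA measurable_upd[OF i] by (rule emeasure_distr[rotated])
  also have "((\<lambda>(x, t). x(i := t)) -` Pi\<^sub>E I A) \<inter> space (P \<Otimes>\<^sub>M \<mu> i) = Pi\<^sub>E I ?B \<times> A i"
  proof (intro set_eqI iffI)
    fix z assume z: "z \<in> ((\<lambda>(x, t). x(i := t)) -` Pi\<^sub>E I A) \<inter> space (P \<Otimes>\<^sub>M \<mu> i)"
    obtain x t where [simp]: "z = (x, t)" by (cases z)
    have "x \<in> Pi\<^sub>E I (\<lambda>j. space (\<mu> j))" and upd: "x(i := t) \<in> Pi\<^sub>E I A"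
      using z by (simp_all add: space_pair_measure space_PiM)
    then have "x j \<in> ?B j" if "j \<in> I" for j
      using PiE_mem[OF upd that] PiE_mem[OF _ that, of x "\<lambda>j. space (\<mu> j)"]
      by (cases "j = i") simp_all
    moreover have "t \<in> A i" using PiE_mem[OF upd i] by simp
    ultimately show "z \<in> Pi\<^sub>E I ?B \<times> A i"
      using \<open>x \<in> Pi\<^sub>E I (\<lambda>j. space (\<mu> j))\<close> by (simp add: PiE_iff)
  next
    fix z assume z: "z \<in> Pi\<^sub>E I ?B \<times> A i"
    obtain x t where [simp]: "z = (x, t)" by (cases z)
    have x: "x \<in> Pi\<^sub>E I ?B" and t: "t \<in> A i" using z by simp_all
    have B': "?B j \<subseteq> space (\<mu> j)" if "j \<in> I" for j
      using B[OF that] by (rule sets.sets_into_space)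
    have "(x(i := t)) j \<in> A j" if "j \<in> I" for j
      using PiE_mem[OF x that] t by (cases "j = i") simp_all
    moreover have "x \<in> space P"
      using PiE_mono[of I ?B "\<lambda>j. space (\<mu> j)", OF B'] x unfolding space_PiM by (rule subsetD)
    moreover have "t \<in> space (\<mu> i)"
      using t sets.sets_into_space[OF A[OF i]] by blast
    ultimately show "z \<in> ((\<lambda>(x, t). x(i := t)) -` Pi\<^sub>E I A) \<inter> space (P \<Otimes>\<^sub>M \<mu> i)"
      using i x by (simp add: space_pair_measure PiE_iff extensional_def)
  qed
  also have "emeasure (P \<Otimes>\<^sub>M \<mu> i) \<dots> = emeasure P (Pi\<^sub>E I ?B) * emeasure (\<mu> i) (A i)"
    using A B i finite_index by (intro M.emeasure_pair_measure_Times sets_PiM_I_finite) auto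
  also have "emeasure P (Pi\<^sub>E I ?B) = (\<Prod>j\<in>I. emeasure (\<mu> j) (?B j))"
    using B by (rule measure_times)
  also have "\<dots> = (\<Prod>j\<in>I - {i}. emeasure (\<mu> j) (A j))"
    using i finite_index by (subst prod.remove[of _ i]) (auto simp: M.emeasure_space_1)
  also have "\<dots> * emeasure (\<mu> i) (A i) = (\<Prod>j\<in>I. emeasure (\<mu> j) (A j))"
    using i finite_index by (subst (2) prod.remove[of _ i]) (auto simp: mult.commute)
  finally show "emeasure (distr (P \<Otimes>\<^sub>M \<mu> i) P (\<lambda>(x, t). x(i := t))) (Pi\<^sub>E I A)
      = (\<Prod>j\<in>I. emeasure (\<mu> j) (A j))" .
qed (use finite_index in auto)

lemma measurable_upd_comp:
  assumes "i \<in> I" "g \<in> borel_measurable P"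
  shows "(\<lambda>(x, t). g (x(i := t))) \<in> borel_measurable (P \<Otimes>\<^sub>M \<mu> i)"
  using measurable_comp[OF measurable_upd[OF assms(1)] assms(2)] by (simp add: comp_def split_beta')

lemma measurable_section:
  assumes "i \<in> I" "x \<in> space P" "g \<in> borel_measurable P"
  shows "(\<lambda>t. g (x(i := t))) \<in> borel_measurable (\<mu> i)"
  using measurable_Pair2[OF measurable_upd_comp[OF assms(1,3)] assms(2)] by simp

lemma nn_integral_upd:
  assumes "i \<in> I" "g \<in> borel_measurable P"
  shows "(\<integral>\<^sup>+x. \<integral>\<^sup>+t. g (x(i := t)) \<partial>\<mu> i \<partial>P) = (\<integral>\<^sup>+x. g x \<partial>P)"
proof -
  have "(\<integral>\<^sup>+x. g x \<partial>P) = (\<integral>\<^sup>+z. g (case z of (x, t) \<Rightarrow> x(i := t)) \<partial>(P \<Otimes>\<^sub>M \<mu> i))"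
    using nn_integral_distr[OF measurable_upd[OF assms(1)], of g] assms(2)
    by (simp add: distr_upd[OF assms(1)])
  also have "\<dots> = (\<integral>\<^sup>+x. \<integral>\<^sup>+t. g (x(i := t)) \<partial>\<mu> i \<partial>P)"
    using measurable_comp[OF measurable_upd[OF assms(1)] assms(2)]
    by (subst M.nn_integral_fst[symmetric]) (auto simp: comp_def)
  finally show ?thesis ..
qed

lemma integrable_upd:
  fixes g :: "_ \<Rightarrow> real"
  assumes "i \<in> I" "integrable P g"
  shows "integrable (P \<Otimes>\<^sub>M \<mu> i) (\<lambda>(x, t). g (x(i := t)))"
  using integrable_distr[OF measurable_upd[OF assms(1)], of g] assms(2)
  by (simp only: distr_upd[OF assms(1)]) (simp only: split_beta')

lemma AE_integrable_section:
  fixes g :: "_ \<Rightarrow> real"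
  assumes "i \<in> I" "integrable P g"
  shows "AE x in P. integrable (\<mu> i) (\<lambda>t. g (x(i := t)))"
proof -
  interpret Pi: pair_sigma_finite P "\<mu> i" ..
  show ?thesis using Pi.AE_integrable_fst[OF integrable_upd[OF assms]] by simp
qed

text \<open>By Fubini a null set meets almost every line in direction \<open>i\<close> in a null
  set. So an almost sure equality survives integration along such lines.\<close>

lemma AE_section:
  assumes "i \<in> I" "AE x in P. Q x"
  shows "AE x in P. AE t in \<mu> i. Q (x(i := t))"
proof -
  interpret Pi: pair_sigma_finite P "\<mu> i" ..
  have "AE z in P \<Otimes>\<^sub>M \<mu> i. Q (case z of (x, t) \<Rightarrow> x(i := t))"
    using AE_distrD[OF measurable_upd[OF assms(1)], of Q] assms(2) by (simp only: distr_upd[OF assms(1)])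
  from Pi.AE_pair[OF this] show ?thesis by simp
qed

section \<open>The operators \<open>cexp\<close> on integrable functions\<close>

lemma integrable_cexp:
  assumes "i \<in> I" "integrable P g" shows "integrable P (cexp \<mu> i g)"
proof -
  interpret Pi: pair_sigma_finite P "\<mu> i" ..
  show ?thesis unfolding cexp_def using Pi.integrable_fst[OF integrable_upd[OF assms]] by simp
qed

lemma integral_cexp:
  assumes "i \<in> I" "integrable P g" shows "(\<integral>x. cexp \<mu> i g x \<partial>P) = (\<integral>x. g x \<partial>P)"
proof -
  interpret Pi: pair_sigma_finite P "\<mu> i" ..
  have "(\<integral>x. g x \<partial>P) = (\<integral>z. (\<lambda>(x, t). g (x(i := t))) z \<partial>(P \<Otimes>\<^sub>M \<mu> i))"
    using integral_distr[OF measurable_upd[OF assms(1)], of g] assms(2)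
    by (simp only: distr_upd[OF assms(1)] borel_measurable_integrable) (simp only: split_beta')
  also have "\<dots> = (\<integral>x. cexp \<mu> i g x \<partial>P)"
    unfolding cexp_def using Pi.integral_fst[OF integrable_upd[OF assms]] by simp
  finally show ?thesis ..
qed

lemma measurable_cexp:
  assumes "i \<in> I" "g \<in> borel_measurable P" shows "cexp \<mu> i g \<in> borel_measurable P"
proof -
  note measurable_upd_comp[OF assms, measurable]
  show ?thesis unfolding cexp_def by measurable
qed

lemma cexp_cong_AE:
  assumes "i \<in> I" "f \<in> borel_measurable P" "g \<in> borel_measurable P" "AE x in P. f x = g x"
  shows "AE x in P. cexp \<mu> i f x = cexp \<mu> i g x"
  using AE_section[OF assms(1,4)] AE_space
proof eventually_elim
  case (elim x)
  show ?case unfolding cexp_def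
    using measurable_section[OF assms(1) elim(2) assms(2)] measurable_section[OF assms(1) elim(2) assms(3)] elim(1)
    by (rule integral_cong_AE)
qed

text \<open>Where a section is not integrable, its integral defaults to 0 and linearity can fail;
  this happens only for a null set of \<open>x\<close>.\<close>

lemma cexp_diff_AE:
  assumes "i \<in> I" "integrable P f" "integrable P g"
  shows "AE x in P. cexp \<mu> i (\<lambda>x. f x - g x) x = cexp \<mu> i f x - cexp \<mu> i g x"
  using AE_integrable_section[OF assms(1,2)] AE_integrable_section[OF assms(1,3)]
  by eventually_elim (simp add: cexp_def)

text \<open>Fubini on the plane through \<open>x\<close> in directions \<open>i\<close> and
  \<open>j\<close>, valid for almost every \<open>x\<close> because \<open>g\<close> is integrable
  on almost every such plane.\<close>

lemma cexp_commute_AE: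
  assumes "i \<in> I" "j \<in> I" "integrable P g"
  shows "AE x in P. cexp \<mu> i (cexp \<mu> j g) x = cexp \<mu> j (cexp \<mu> i g) x"
proof (cases "i = j")
  case False
  interpret ij: pair_sigma_finite "\<mu> i" "\<mu> j" ..
  interpret ij: prob_space "\<mu> i \<Otimes>\<^sub>M \<mu> j"
    by (intro prob_space_pair M.prob_space_axioms)
  interpret Pij: pair_sigma_finite P "\<mu> i \<Otimes>\<^sub>M \<mu> j" ..
  have gm: "g \<in> borel_measurable P" using assms(3) by simp
  note gj = measurable_upd_comp[OF assms(2) gm]
  have "(\<lambda>(x, t, s). ((\<lambda>(x, t). x(i := t)) (x, t), s)) \<in> P \<Otimes>\<^sub>M (\<mu> i \<Otimes>\<^sub>M \<mu> j) \<rightarrow>\<^sub>M P \<Otimes>\<^sub>M \<mu> j"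
    using assms(1) by measurable
  from measurable_comp[OF this gj]
  have m: "(\<lambda>(x, t, s). g (x(i := t, j := s))) \<in> borel_measurable (P \<Otimes>\<^sub>M (\<mu> i \<Otimes>\<^sub>M \<mu> j))"
    by (simp add: comp_def split_beta')
  have "integrable (P \<Otimes>\<^sub>M (\<mu> i \<Otimes>\<^sub>M \<mu> j)) (\<lambda>(x, t, s). g (x(i := t, j := s)))"
  proof (rule integrableI_bounded[OF m])
    \<comment> \<open>With the inner integral named \<open>h\<close>, the invariance under
      resampling applies first to \<open>h\<close> in coordinate \<open>i\<close> and then to the
      absolute value of \<open>g\<close> in coordinate \<open>j\<close>.\<close>
    define h where "h x = (\<integral>\<^sup>+s. norm (g (x(j := s))) \<partial>\<mu> j)" for x
    have "h \<in> borel_measurable P"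
      unfolding h_def using gj by measurable
    note h = nn_integral_upd[OF assms(1) this]
    have "(\<integral>\<^sup>+z. norm (case z of (x, t, s) \<Rightarrow> g (x(i := t, j := s))) \<partial>(P \<Otimes>\<^sub>M (\<mu> i \<Otimes>\<^sub>M \<mu> j)))
       = (\<integral>\<^sup>+x. \<integral>\<^sup>+y. norm (case y of (t, s) \<Rightarrow> g (x(i := t, j := s))) \<partial>(\<mu> i \<Otimes>\<^sub>M \<mu> j) \<partial>P)"
      using m by (subst ij.nn_integral_fst[symmetric]) auto
    also have "\<dots> = (\<integral>\<^sup>+x. \<integral>\<^sup>+t. h (x(i := t)) \<partial>\<mu> i \<partial>P)"
      unfolding h_def
    proof (intro nn_integral_cong)
      fix x assume x: "x \<in> space P"
      have "(\<lambda>y. norm (case y of (t, s) \<Rightarrow> g (x(i := t, j := s)))) \<in> borel_measurable (\<mu> i \<Otimes>\<^sub>M \<mu> j)"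
        using measurable_Pair2[OF m x] by simp
      then show "(\<integral>\<^sup>+y. norm (case y of (t, s) \<Rightarrow> g (x(i := t, j := s))) \<partial>(\<mu> i \<Otimes>\<^sub>M \<mu> j))
          = (\<integral>\<^sup>+t. \<integral>\<^sup>+s. norm (g (x(i := t, j := s))) \<partial>\<mu> j \<partial>\<mu> i)"
        by (subst M.nn_integral_fst[symmetric]) auto
    qed
    also have "\<dots> = (\<integral>\<^sup>+x. norm (g x) \<partial>P)"
      unfolding h unfolding h_def using gm assms(2) by (intro nn_integral_upd) auto
    also have "\<dots> < \<infinity>" using assms(3) by (simp add: integrable_iff_bounded)
    finally show "(\<integral>\<^sup>+z. norm (case z of (x, t, s) \<Rightarrow> g (x(i := t, j := s))) \<partial>(P \<Otimes>\<^sub>M (\<mu> i \<Otimes>\<^sub>M \<mu> j))) < \<infinity>" .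
  qed
  from Pij.AE_integrable_fst'[OF this]
  show ?thesis
  proof eventually_elim
    case (elim x)
    then have "(\<integral>s. \<integral>t. g (x(i := t, j := s)) \<partial>\<mu> i \<partial>\<mu> j) = (\<integral>t. \<integral>s. g (x(i := t, j := s)) \<partial>\<mu> j \<partial>\<mu> i)"
      by (intro ij.Fubini_integral) simp
    then show ?case using False by (simp add: cexp_def fun_upd_twist)
  qed
qed simp

section \<open>The square norm of iterated differences\<close>

definition sq_int :: "((nat \<Rightarrow> real) \<Rightarrow> real) \<Rightarrow> bool" where
  "sq_int g \<longleftrightarrow> g \<in> borel_measurable P \<and> integrable P (\<lambda>x. (g x)\<^sup>2)"

definition sqnorm :: "((nat \<Rightarrow> real) \<Rightarrow> real) \<Rightarrow> real" where
  "sqnorm g = (\<integral>x. (g x)\<^sup>2 \<partial>P)"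

lemma sqnorm_nonneg: "0 \<le> sqnorm g"
  by (simp add: sqnorm_def)

lemma sqnorm_cong_AE:
  assumes "sq_int f" "sq_int g" "AE x in P. f x = g x"
  shows "sqnorm f = sqnorm g"
  using assms unfolding sqnorm_def sq_int_def by (intro integral_cong_AE) auto

lemma sq_int_measurable [measurable_dest]: "sq_int g \<Longrightarrow> g \<in> borel_measurable P"
  by (simp add: sq_int_def)

lemma sq_int_integrable: "sq_int g \<Longrightarrow> integrable P g"
  unfolding sq_int_def by (blast intro: square_integrable_imp_integrable)

lemma sq_int_integrable_mult:
  assumes "sq_int f" "sq_int g" shows "integrable P (\<lambda>x. f x * g x)"
proof (rule Bochner_Integration.integrable_bound)
  show "integrable P (\<lambda>x. (f x)\<^sup>2 + (g x)\<^sup>2)" using assms by (auto simp: sq_int_def)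
  show "(\<lambda>x. f x * g x) \<in> borel_measurable P" using assms by (auto simp: sq_int_def)
  have "\<bar>a * b\<bar> \<le> a\<^sup>2 + b\<^sup>2" for a b :: real
    using sum_squares_bound[of "\<bar>a\<bar>" "\<bar>b\<bar>"] abs_ge_zero[of "a * b"]
    unfolding power2_abs abs_mult by linarith
  then show "AE x in P. norm (f x * g x) \<le> norm ((f x)\<^sup>2 + (g x)\<^sup>2)" by simp
qed

lemma sq_int_diff:
  assumes "sq_int f" "sq_int g" shows "sq_int (\<lambda>x. f x - g x)"
  using assms sq_int_integrable_mult[OF assms]
  by (auto simp: sq_int_def power2_diff mult.assoc)

text \<open>Conditional Jensen: on almost every line the square of the mean is at most the mean of
  the square, and the latter is integrable.\<close>

lemma sq_int_cexp:
  assumes "i \<in> I" "sq_int g" shows "sq_int (cexp \<mu> i g)"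
  unfolding sq_int_def
proof
  show m: "cexp \<mu> i g \<in> borel_measurable P"
    using assms by (simp add: measurable_cexp sq_int_measurable)
  have i2: "integrable P (\<lambda>x. (g x)\<^sup>2)" using assms(2) by (simp add: sq_int_def)
  have "AE x in P. (cexp \<mu> i g x)\<^sup>2 \<le> cexp \<mu> i (\<lambda>x. (g x)\<^sup>2) x"
    using AE_integrable_section[OF assms(1) i2] AE_space
  proof eventually_elim
    case (elim x)
    show ?case
      unfolding cexp_def
      by (rule M.expectation_square_le[OF elim(1) measurable_section[OF assms(1) elim(2) sq_int_measurable[OF assms(2)]]])
  qed
  then have "AE x in P. norm ((cexp \<mu> i g x)\<^sup>2) \<le> norm (cexp \<mu> i (\<lambda>x. (g x)\<^sup>2) x)"
    by eventually_elim auto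
  then show "integrable P (\<lambda>x. (cexp \<mu> i g x)\<^sup>2)"
    using m by (intro Bochner_Integration.integrable_bound[OF integrable_cexp[OF assms(1) i2]]) simp_all
qed

text \<open>Pythagoras for the projection \<open>E_i\<close>: the inner product of \<open>g\<close>
  with \<open>E_i g\<close> equals the square norm of \<open>E_i g\<close>.\<close>

lemma sqnorm_diff_cexp:
  assumes "i \<in> I" "sq_int g"
  shows "sqnorm (\<lambda>x. g x - cexp \<mu> i g x) = sqnorm g - sqnorm (cexp \<mu> i g)"
proof -
  have E: "sq_int (cexp \<mu> i g)" using assms by (rule sq_int_cexp)
  note ints = sq_int_integrable_mult[OF assms(2) E]
  have "(\<integral>x. g x * cexp \<mu> i g x \<partial>P) = (\<integral>x. cexp \<mu> i (\<lambda>x. g x * cexp \<mu> i g x) x \<partial>P)"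
    by (rule integral_cexp[OF assms(1) ints, symmetric])
  also have "\<dots> = sqnorm (cexp \<mu> i g)"
    by (simp add: cexp_mult_cexp sqnorm_def power2_eq_square)
  finally show ?thesis
    using ints assms(2) E
    by (simp add: sqnorm_def power2_diff sq_int_def mult.assoc)
qed

lemma sq_int_cdiff: "set js \<subseteq> I \<Longrightarrow> sq_int g \<Longrightarrow> sq_int (cdiff \<mu> js g)"
  by (induction js) (simp_all add: sq_int_diff sq_int_cexp)

text \<open>\<open>E_i\<close> commutes with each factor \<open>1 - E_j\<close>. The null sets of
  the single exchanges are finitely many, one batch for each list entry.\<close>

lemma cexp_cdiff_AE:
  assumes "i \<in> I" "sq_int g" "set js \<subseteq> I"
  shows "AE x in P. cexp \<mu> i (cdiff \<mu> js g) x = cdiff \<mu> js (cexp \<mu> i g) x"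
  using assms(3)
proof (induction js)
  case (Cons j js)
  let ?D = "cdiff \<mu> js g" and ?D' = "cdiff \<mu> js (cexp \<mu> i g)"
  have j: "j \<in> I" and js: "set js \<subseteq> I" using Cons.prems by auto
  have D: "sq_int ?D" using js assms(2) by (rule sq_int_cdiff)
  have D': "sq_int ?D'" using js sq_int_cexp[OF assms(1,2)] by (rule sq_int_cdiff)
  have IH: "AE x in P. cexp \<mu> i ?D x = ?D' x" using Cons.IH js by blast
  have "AE x in P. cexp \<mu> j (cexp \<mu> i ?D) x = cexp \<mu> j ?D' x"
    using j IH D D' assms(1) by (intro cexp_cong_AE sq_int_measurable sq_int_cexp)
  moreover have "AE x in P. cexp \<mu> i (\<lambda>x. ?D x - cexp \<mu> j ?D x) x
      = cexp \<mu> i ?D x - cexp \<mu> i (cexp \<mu> j ?D) x"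
    using D j assms(1) by (intro cexp_diff_AE sq_int_integrable sq_int_cexp)
  moreover have "AE x in P. cexp \<mu> i (cexp \<mu> j ?D) x = cexp \<mu> j (cexp \<mu> i ?D) x"
    using D j assms(1) by (intro cexp_commute_AE sq_int_integrable)
  ultimately show ?case using IH unfolding cdiff.simps by eventually_elim simp
qed simp

text \<open>Pythagoras for \<open>cdiff \<mu> js g\<close>, with \<open>E_i\<close> then moved
  inside past the differences. This has the shape of the recursion of \<open>cvar\<close> after
  integration.\<close>

lemma sqnorm_cdiff_Cons:
  assumes "i \<in> I" "sq_int g" "set js \<subseteq> I"
  shows "sqnorm (cdiff \<mu> (i # js) g) = sqnorm (cdiff \<mu> js g) - sqnorm (cdiff \<mu> js (cexp \<mu> i g))"
  using sqnorm_diff_cexp[OF assms(1) sq_int_cdiff[OF assms(3,2)]]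
    sqnorm_cong_AE[OF _ _ cexp_cdiff_AE[OF assms]] assms
  by (simp add: sq_int_cdiff sq_int_cexp)

text \<open>Both sides obey the same recursion, since integration absorbs the outer
  \<open>cexp\<close>. The empty list is excluded: there \<open>cvar\<close> is the placeholder 0,
  while \<open>cdiff\<close> returns \<open>g\<close> itself.\<close>

lemma integral_cvar:
  assumes "js \<noteq> []" "set js \<subseteq> I" "sq_int g"
  shows "integrable P (cvar \<mu> js g) \<and> (\<integral>x. cvar \<mu> js g x \<partial>P) = sqnorm (cdiff \<mu> js g)"
  using assms
proof (induction js arbitrary: g rule: induct_list012)
  case (2 i)
  then have "sq_int (\<lambda>x. g x - cexp \<mu> i g x)" by (simp add: sq_int_diff sq_int_cexp)
  then have "integrable P (\<lambda>x. (g x - cexp \<mu> i g x)\<^sup>2)" by (simp add: sq_int_def)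
  with 2 show ?case by (simp add: integrable_cexp integral_cexp sqnorm_def)
next
  case (3 i j js)
  have i: "i \<in> I" and js: "set (j # js) \<subseteq> I" using 3 by auto
  have E: "sq_int (cexp \<mu> i g)" using i "3.prems"(3) by (rule sq_int_cexp)
  have IH: "integrable P (cvar \<mu> (j # js) h) \<and> (\<integral>x. cvar \<mu> (j # js) h x \<partial>P) = sqnorm (cdiff \<mu> (j # js) h)"
    if "sq_int h" for h
    using "3.IH"(2) js that by blast
  show ?case
    using IH[OF "3.prems"(3)] IH[OF E] sqnorm_cdiff_Cons[OF i "3.prems"(3) js] i
    by (simp add: integrable_cexp integral_cexp del: cdiff.simps)
qed simp

end

section \<open>Removing one index\<close>

text \<open>\<open>index_tuples\<close> over an arbitrary index set, so that single indices can be
  removed.\<close>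

definition index_lists :: "nat set \<Rightarrow> nat \<Rightarrow> nat list set" where
  "index_lists J k = {js. length js = k \<and> sorted_wrt (<) js \<and> set js \<subseteq> J}"

lemma index_tuples_eq: "index_tuples n k = index_lists {1..n} k"
  by (simp add: index_tuples_def index_lists_def)

lemma finite_index_lists: "finite J \<Longrightarrow> finite (index_lists J k)"
  by (rule finite_subset[OF _ finite_lists_length_eq[of J k]]) (auto simp: index_lists_def)

lemma index_lists_0 [simp]: "index_lists J 0 = {[]}"
  by (auto simp: index_lists_def)

lemma index_lists_empty:
  assumes "finite J" "card J < k" shows "index_lists J k = {}"
proof -
  have False if "js \<in> index_lists J k" for js
  proof -
    have js: "length js = k" "distinct js" "set js \<subseteq> J"
      using that by (simp_all add: index_lists_def strict_sorted_iff)
    show False using card_mono[OF assms(1) js(3)] assms(2) distinct_card[OF js(2)] js(1) by simp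
  qed
  then show ?thesis by blast
qed

text \<open>As \<open>i\<close> lies below all of \<open>J\<close>, an increasing list that contains
  \<open>i\<close> must start with it.\<close>

lemma index_lists_insert:
  assumes "\<forall>j\<in>J. i < j"
  shows "index_lists (insert i J) (Suc k) = index_lists J (Suc k) \<union> (#) i ` index_lists J k"
proof (intro set_eqI iffI)
  fix js assume "js \<in> index_lists (insert i J) (Suc k)"
  then obtain a as where js: "js = a # as" and as: "length as = k" "sorted_wrt (<) as"
      "\<forall>b\<in>set as. a < b" "a \<in> insert i J" "set as \<subseteq> insert i J"
    by (auto simp: index_lists_def length_Suc_conv)
  have "i \<le> a" using as(4) assms by (auto intro: less_imp_le)
  then have "i \<notin> set as" using as(3) by (meson leD)
  with as(5) have "set as \<subseteq> J" by blast
  with js as show "js \<in> index_lists J (Suc k) \<union> (#) i ` index_lists J k"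
    by (cases "a = i") (auto simp: index_lists_def)
next
  fix js assume "js \<in> index_lists J (Suc k) \<union> (#) i ` index_lists J k"
  then show "js \<in> index_lists (insert i J) (Suc k)"
  proof
    assume "js \<in> (#) i ` index_lists J k"
    then obtain as where "js = i # as" "as \<in> index_lists J k" by blast
    moreover from this have "\<forall>b\<in>set as. i < b" using assms by (auto simp: index_lists_def)
    ultimately show ?thesis by (auto simp: index_lists_def)
  qed (auto simp: index_lists_def)
qed

section \<open>Recursion and sign of the alternating sums\<close>

context real_product_prob_space
begin

text \<open>For \<open>k = 0\<close> the only list is empty, so the value is the second moment
  \<open>sqnorm g\<close>.\<close>

definition level_sum :: "nat set \<Rightarrow> nat \<Rightarrow> ((nat \<Rightarrow> real) \<Rightarrow> real) \<Rightarrow> real" where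
  "level_sum J k g = (\<Sum>js\<in>index_lists J k. sqnorm (cdiff \<mu> js g))"

definition alt_sum :: "nat set \<Rightarrow> nat \<Rightarrow> ((nat \<Rightarrow> real) \<Rightarrow> real) \<Rightarrow> real" where
  "alt_sum J m g = (\<Sum>k\<le>m. (-1) ^ k * level_sum J k g)"

lemma alt_sum_Suc: "alt_sum J (Suc m) g = alt_sum J m g + (-1) ^ Suc m * level_sum J (Suc m) g"
  by (simp add: alt_sum_def)

text \<open>Exhibits the difference as a sum of square norms, from which its sign, and its vanishing
  when no list of length \<open>k\<close> exists, can be read off.\<close>

lemma level_sum_diff:
  assumes "i \<in> I" "J \<subseteq> I" "sq_int g"
  shows "level_sum J k g - level_sum J k (cexp \<mu> i g)
    = (\<Sum>js\<in>index_lists J k. sqnorm (cdiff \<mu> (i # js) g))"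
  unfolding level_sum_def sum_subtractf[symmetric] using assms
  by (intro sum.cong refl sqnorm_cdiff_Cons[symmetric]) (auto simp: index_lists_def)

lemma level_sum_insert:
  assumes "insert i J \<subseteq> I" "\<forall>j\<in>J. i < j" "sq_int g"
  shows "level_sum (insert i J) (Suc k) g
    = level_sum J (Suc k) g + (level_sum J k g - level_sum J k (cexp \<mu> i g))"
proof -
  have fin: "finite J" using assms(1) by (intro finite_subset[OF _ finite_index]) simp
  have "i \<notin> J" using assms(2) by blast
  then have "index_lists J (Suc k) \<inter> (#) i ` index_lists J k = {}"
    by (auto simp: index_lists_def)
  then have "level_sum (insert i J) (Suc k) g
     = level_sum J (Suc k) g + (\<Sum>js\<in>(#) i ` index_lists J k. sqnorm (cdiff \<mu> js g))"
    unfolding level_sum_def index_lists_insert[OF assms(2)]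
    using fin by (intro sum.union_disjoint) (simp_all add: finite_index_lists)
  also have "(\<Sum>js\<in>(#) i ` index_lists J k. sqnorm (cdiff \<mu> js g))
      = (\<Sum>js\<in>index_lists J k. sqnorm (cdiff \<mu> (i # js) g))"
    by (simp add: sum.reindex comp_def del: cdiff.simps)
  also have "\<dots> = level_sum J k g - level_sum J k (cexp \<mu> i g)"
    using assms(1,3) by (intro level_sum_diff[symmetric]) simp_all
  finally show ?thesis .
qed

text \<open>Let \<open>d k\<close> be the difference of \<open>level_sum J k\<close> at
  \<open>g\<close> and at \<open>E_i g\<close>. For \<open>k \<ge> 1\<close> the level
  \<open>k\<close> of the larger set is
  \<open>level_sum J k (cexp \<mu> i g) + d k + d (k - 1)\<close>; with alternating signs the
  \<open>d\<close> terms telescope and only the last one remains.\<close>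

lemma alt_sum_insert:
  assumes "insert i J \<subseteq> I" "\<forall>j\<in>J. i < j" "sq_int g"
  shows "alt_sum (insert i J) m g
    = alt_sum J m (cexp \<mu> i g) + (-1) ^ m * (level_sum J m g - level_sum J m (cexp \<mu> i g))"
proof (induction m)
  case 0
  then show ?case by (simp add: alt_sum_def level_sum_def)
next
  case (Suc m)
  have "alt_sum (insert i J) (Suc m) g
      = alt_sum (insert i J) m g + (-1) ^ Suc m * level_sum (insert i J) (Suc m) g"
    by (rule alt_sum_Suc)
  also have "\<dots> = alt_sum J (Suc m) (cexp \<mu> i g)
      + (-1) ^ Suc m * (level_sum J (Suc m) g - level_sum J (Suc m) (cexp \<mu> i g))"
    unfolding Suc.IH level_sum_insert[OF assms] alt_sum_Suc[of J m] power_Suc by algebra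
  finally show ?case .
qed

text \<open>Induction on the indices for all \<open>g\<close> at once, because removing
  \<open>i\<close> replaces \<open>g\<close> by \<open>cexp \<mu> i g\<close>. \<open>fold\<close>
  applies the head first, which matches this order.\<close>

lemma alt_sum_bounds:
  assumes "sorted_wrt (<) js" "set js \<subseteq> I" "sq_int g"
  shows "0 \<le> (-1) ^ m * (alt_sum (set js) m g - sqnorm (fold (cexp \<mu>) js g))"
    and "length js \<le> m \<Longrightarrow> alt_sum (set js) m g = sqnorm (fold (cexp \<mu>) js g)"
  using assms
proof (induction js arbitrary: g)
  case Nil
  \<comment> \<open>Without indices only level 0 survives, so the alternating sum equals
    \<open>sqnorm g\<close> for every \<open>m\<close>.\<close>
  have "level_sum {} (Suc k) g = 0" for k g
    by (simp add: level_sum_def index_lists_empty)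
  then have *: "alt_sum {} m g = sqnorm g" for g
    by (induction m) (simp_all add: alt_sum_Suc, simp add: alt_sum_def level_sum_def)
  { case 1 then show ?case by (simp add: *) }
  { case 2 then show ?case by (simp add: *) }
next
  case (Cons i js)
  have *: "alt_sum (set (i # js)) m g = alt_sum (set js) m (cexp \<mu> i g)
      + (-1) ^ m * (\<Sum>ks\<in>index_lists (set js) m. sqnorm (cdiff \<mu> (i # ks) g))"
    if "sorted_wrt (<) (i # js)" "set (i # js) \<subseteq> I" "sq_int g" for g
    using that alt_sum_insert[of i "set js" g m] level_sum_diff[of i "set js" g m]
    by (simp del: cdiff.simps)
  { case (1 g)
    then have "0 \<le> (-1) ^ m * (alt_sum (set js) m (cexp \<mu> i g) - sqnorm (fold (cexp \<mu>) js (cexp \<mu> i g)))"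
      by (intro Cons.IH(1)) (simp_all add: sq_int_cexp)
    moreover have "0 \<le> (\<Sum>ks\<in>index_lists (set js) m. sqnorm (cdiff \<mu> (i # ks) g))"
      by (intro sum_nonneg sqnorm_nonneg)
    \<comment> \<open>The sign in front of the remainder cancels against the outer sign, so the
      remainder enters nonnegatively whatever the parity of \<open>m\<close>.\<close>
    moreover have "(-1) ^ m * (a + (-1) ^ m * r - s) = (-1) ^ m * (a - s) + r" for a r s :: real
      by (cases "even m") simp_all
    ultimately show ?case unfolding *[OF 1] fold_Cons comp_apply by (simp only: add_nonneg_nonneg) }
  { case (2 g)
    \<comment> \<open>Here \<open>m\<close> is at least the length of \<open>i # js\<close>, hence
      strictly larger than the number of remaining indices, and the remainder is an empty
      sum.\<close>
    then have "index_lists (set js) m = {}"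
      using card_length[of js] by (intro index_lists_empty) simp_all
    then have "alt_sum (set (i # js)) m g = alt_sum (set js) m (cexp \<mu> i g)"
      using *[OF 2(2-4)] by simp
    also have "\<dots> = sqnorm (fold (cexp \<mu>) js (cexp \<mu> i g))"
      using 2 by (intro Cons.IH(2)) (simp_all add: sq_int_cexp)
    finally show ?case by simp }
qed

end

section \<open>Integrating out all coordinates\<close>

text \<open>A coordinate once integrated out stays out: integrating over another coordinate does not
  bring it back. The induction runs from the end of the list, since \<open>fold\<close> puts the
  last operator outermost.\<close>

lemma fold_cexp_upd: "i \<in> set js \<Longrightarrow> fold (cexp \<mu>) js g (x(i := t)) = fold (cexp \<mu>) js g x"
proof (induction js arbitrary: x rule: rev_induct)
  case (snoc j js)
  show ?case
  proof (cases "i = j")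
    case False
    have "fold (cexp \<mu>) js g (x(i := t, j := s)) = fold (cexp \<mu>) js g (x(j := s))" for s
      unfolding fun_upd_twist[OF False] using snoc False by (intro snoc.IH) simp
    then have "cexp \<mu> j (fold (cexp \<mu>) js g) (x(i := t)) = cexp \<mu> j (fold (cexp \<mu>) js g) x"
      by (rule cexp_eqI)
    then show ?thesis by (simp del: fun_upd_apply)
  qed (simp del: fun_upd_apply)
qed simp

text \<open>Walk from \<open>x\<close> to \<open>y\<close> by changing one coordinate of
  \<open>J\<close> at a time.\<close>

lemma eq_if_agree_off:
  assumes "finite J" "\<And>j x t. j \<in> J \<Longrightarrow> f (x(j := t)) = f x" "\<And>j. j \<notin> J \<Longrightarrow> x j = y j"
  shows "f x = f y"
  using assms
proof (induction J arbitrary: x rule: finite_induct)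
  case empty
  then have "x = y" by (intro ext) simp
  then show ?case by simp
next
  case (insert j J)
  have "f x = f (x(j := y j))"
    by (rule insert.prems(1)[symmetric]) simp
  also have "\<dots> = f y"
  proof (rule insert.IH)
    show "f (x(k := t)) = f x" if "k \<in> J" for k x t
      using insert.prems(1) that by blast
    show "(x(j := y j)) k = y k" if "k \<notin> J" for k
      using insert.prems(2)[of k] that by (cases "k = j") simp_all
  qed
  finally show ?case .
qed

context real_product_prob_space
begin

lemma fold_cexp_integral:
  assumes "set js \<subseteq> I" "integrable P g"
  shows "integrable P (fold (cexp \<mu>) js g) \<and> (\<integral>x. fold (cexp \<mu>) js g x \<partial>P) = (\<integral>x. g x \<partial>P)"
  using assms by (induction js arbitrary: g) (simp_all add: integrable_cexp integral_cexp)

text \<open>With all coordinates integrated out the function is constant on \<open>space P\<close>,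
  whose points agree outside \<open>I\<close> by extensionality. The constant is the mean of
  \<open>g\<close>, because each \<open>cexp\<close> preserves the integral.\<close>

lemma sqnorm_fold_cexp:
  assumes "set js = I" "integrable P g"
  shows "sqnorm (fold (cexp \<mu>) js g) = (\<integral>x. g x \<partial>P)\<^sup>2"
proof -
  obtain x0 where x0: "x0 \<in> space P" using P.not_empty by blast
  let ?f = "fold (cexp \<mu>) js g"
  have c: "?f x = ?f x0" if "x \<in> space P" for x
  proof (rule eq_if_agree_off[where f = ?f, OF finite_index])
    show "?f (y(j := t)) = ?f y" if "j \<in> I" for j y t
      using that assms(1) by (intro fold_cexp_upd) simp
    fix j assume "j \<notin> I"
    show "x j = x0 j"
      using \<open>x \<in> space P\<close> x0 \<open>j \<notin> I\<close> by (simp add: space_PiM PiE_iff extensional_def)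
  qed
  have "(\<integral>x. g x \<partial>P) = (\<integral>x. ?f x \<partial>P)"
    using fold_cexp_integral[of js g] assms by simp
  also have "\<dots> = (\<integral>x. ?f x0 \<partial>P)"
    using c by (intro Bochner_Integration.integral_cong) auto
  finally have "(\<integral>x. g x \<partial>P) = ?f x0" by (simp add: P.prob_space)
  moreover have "sqnorm ?f = (\<integral>x. (?f x0)\<^sup>2 \<partial>P)"
    unfolding sqnorm_def using c by (intro Bochner_Integration.integral_cong) auto
  ultimately show ?thesis by (simp add: P.prob_space)
qed

text \<open>The level 0 term of \<open>alt_sum\<close> and the squared mean combine to the variance.
  The sum is a lower bound for even \<open>m\<close> and an upper bound for odd
  \<open>m\<close>.\<close>

lemma variance_level_sums:
  assumes "sq_int g"
  shows "0 \<le> (-1) ^ m * (P.variance g - (\<Sum>k=1..m. (-1) ^ (k + 1) * level_sum I k g))"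
    and "card I \<le> m \<Longrightarrow> P.variance g = (\<Sum>k=1..m. (-1) ^ (k + 1) * level_sum I k g)"
proof -
  define js where "js = sorted_list_of_set I"
  have js: "sorted_wrt (<) js" "set js = I" "length js = card I"
    using finite_index by (simp_all add: js_def)
  have "alt_sum I m g = sqnorm g + (\<Sum>k=1..m. (-1) ^ k * level_sum I k g)"
    unfolding alt_sum_def by (simp add: sum.atMost_shift level_sum_def sum.atLeast1_atMost_eq lessThan_Suc_atMost)
  also have "\<dots> = sqnorm g - (\<Sum>k=1..m. (-1) ^ (k + 1) * level_sum I k g)"
    by (simp add: sum_negf)
  finally have "alt_sum I m g - sqnorm (fold (cexp \<mu>) js g)
      = P.variance g - (\<Sum>k=1..m. (-1) ^ (k + 1) * level_sum I k g)"
    using sq_int_integrable[OF assms] assms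
    by (simp only: sqnorm_fold_cexp[OF js(2)]) (simp add: P.variance_eq sqnorm_def sq_int_def)
  with alt_sum_bounds[of js g m] js assms
  show "0 \<le> (-1) ^ m * (P.variance g - (\<Sum>k=1..m. (-1) ^ (k + 1) * level_sum I k g))"
    and "card I \<le> m \<Longrightarrow> P.variance g = (\<Sum>k=1..m. (-1) ^ (k + 1) * level_sum I k g)"
    by simp_all
qed

text \<open>\<open>k \<ge> 1\<close> keeps the index lists nonempty, so \<open>integral_cvar\<close>
  applies to every summand.\<close>

lemma integral_jackknife:
  assumes "I = {1..n}" "k \<ge> 1" "sq_int g"
  shows "integrable P (jackknife \<mu> n k g)"
    and "(\<integral>x. jackknife \<mu> n k g x \<partial>P) = fact k * level_sum I k g"
proof -
  have *: "integrable P (cvar \<mu> js g) \<and> (\<integral>x. cvar \<mu> js g x \<partial>P) = sqnorm (cdiff \<mu> js g)"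
    if "js \<in> index_lists I k" for js
    using that assms(2,3) by (intro integral_cvar) (auto simp: index_lists_def)
  have eq: "jackknife \<mu> n k g = (\<lambda>x. fact k * (\<Sum>js\<in>index_lists I k. cvar \<mu> js g x))"
    by (simp add: fun_eq_iff jackknife_def index_tuples_eq assms(1))
  show "integrable P (jackknife \<mu> n k g)"
    unfolding eq using * by (intro integrable_mult_right Bochner_Integration.integrable_sum) auto
  show "(\<integral>x. jackknife \<mu> n k g x \<partial>P) = fact k * level_sum I k g"
    unfolding eq using * by (simp add: level_sum_def Bochner_Integration.integral_sum)
qed

end

section \<open>From the product space to the sample\<close>

lemma cvar_cong_laws:
  assumes "\<And>i. i \<in> set js \<Longrightarrow> \<mu> i = \<nu> i"
  shows "cvar \<mu> js g = cvar \<nu> js g"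
proof -
  have "cexp \<mu> i = cexp \<nu> i" if "i \<in> set js" for i
    using assms[OF that] by (simp add: fun_eq_iff cexp_def)
  then show ?thesis
    by (induction js arbitrary: g rule: induct_list012) simp_all
qed

text \<open>Allows the laws outside \<open>{1..n}\<close> to be replaced by arbitrary probability
  measures, as the locale wants a probability measure at every index.\<close>

lemma jackknife_cong_laws:
  assumes "\<And>i. i \<in> {1..n} \<Longrightarrow> \<mu> i = \<nu> i"
  shows "jackknife \<mu> n k g = jackknife \<nu> n k g"
  unfolding jackknife_def fun_eq_iff using assms
  by (intro allI arg_cong[where f="\<lambda>s. fact k * s"] sum.cong refl fun_cong[OF cvar_cong_laws])
    (auto simp: index_tuples_def)

theorem theorem2p1:
  fixes M :: "'a measure"
    and n :: nat
    and X :: "nat \<Rightarrow> 'a \<Rightarrow> real"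
    and S :: "(nat \<Rightarrow> real) \<Rightarrow> real"
  assumes "prob_space M"
    and "n \<ge> 1"
    and "prob_space.indep_vars M (\<lambda>_. borel) X {1..n}"
    and "S \<in> borel_measurable (PiM {1..n} (\<lambda>_. borel))"
    and "integrable M (\<lambda>\<omega>. (S (sample X n \<omega>))\<^sup>2)"
  shows "(\<forall>p\<in>{1..n div 2}.
           (\<Sum>k=1..2*p. (-1)^(k+1) / fact k *
              prob_space.expectation M (\<lambda>\<omega>. jackknife (laws M X) n k S (sample X n \<omega>)))
             \<le> prob_space.variance M (\<lambda>\<omega>. S (sample X n \<omega>)) \<and>
           prob_space.variance M (\<lambda>\<omega>. S (sample X n \<omega>))
             \<le> (\<Sum>k=1..2*p-1. (-1)^(k+1) / fact k *
                  prob_space.expectation M (\<lambda>\<omega>. jackknife (laws M X) n k S (sample X n \<omega>))))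
       \<and> prob_space.variance M (\<lambda>\<omega>. S (sample X n \<omega>)) =
           (\<Sum>k=1..n. (-1)^(k+1) / fact k *
              prob_space.expectation M (\<lambda>\<omega>. jackknife (laws M X) n k S (sample X n \<omega>)))"
proof -
  interpret prob_space M by fact
  define I where "I = {1..n}"
  \<comment> \<open>\<open>laws M X j\<close> need not be a probability measure when \<open>j \<notin> I\<close>.\<close>
  define N where "N j = (if j \<in> I then laws M X j else return borel 0)" for j
  have Xm: "random_variable borel (X j)" if "j \<in> I" for j
    using assms(3) that by (auto simp: indep_vars_def I_def)
  have sN: "sets (N j) = sets borel" for j
    by (simp add: N_def laws_def)
  have pN: "prob_space (N j)" for j
    using Xm by (auto simp: N_def laws_def intro!: prob_space_distr prob_space_return)
  interpret NP: real_product_prob_space N I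
    using pN
    by (auto simp: real_product_prob_space_def finite_product_prob_space_def
        finite_product_sigma_finite_def finite_product_sigma_finite_axioms_def product_prob_space_def
        product_prob_space_axioms_def product_sigma_finite_def I_def intro: prob_space_imp_sigma_finite)
  have sP: "sets NP.P = sets (PiM I (\<lambda>_. borel))"
    by (intro sets_PiM_cong refl sN)
  have smp: "sample X n = (\<lambda>\<omega>. \<lambda>j\<in>I. X j \<omega>)"
    by (simp add: sample_def I_def fun_eq_iff)
  have smP: "sample X n \<in> M \<rightarrow>\<^sub>M NP.P"
    unfolding measurable_cong_sets[OF refl sP] smp by (intro measurable_restrict Xm)
  have "distr M NP.P (sample X n) = distr M (PiM I (\<lambda>_. borel)) (sample X n)"
    by (intro distr_cong refl) (simp add: sP)
  also have "\<dots> = PiM I (\<lambda>j. distr M borel (X j))"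
    \<comment> \<open>Independence says that the joint law is the product of the marginals;
      \<open>n \<ge> 1\<close> provides the nonempty index set for this characterisation.\<close>
    using indep_vars_iff_distr_eq_PiM'[where I=I and M'="\<lambda>_. borel" and X=X] assms(2,3) Xm
    unfolding smp I_def[symmetric] by (simp add: I_def)
  also have "\<dots> = NP.P"
    by (intro PiM_cong refl) (simp add: N_def laws_def)
  finally have D: "distr M NP.P (sample X n) = NP.P" .
  have transfer: "(\<integral>\<omega>. f (sample X n \<omega>) \<partial>M) = (\<integral>x. f x \<partial>NP.P)"
    if "f \<in> borel_measurable NP.P" for f :: "_ \<Rightarrow> real"
    using integral_distr[OF smP that] by (simp add: D)
  have Sm: "S \<in> borel_measurable NP.P"
    using assms(4) by (simp only: measurable_cong_sets[OF sP refl] I_def[symmetric])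
  have S: "NP.sq_int S"
    unfolding NP.sq_int_def using Sm assms(5) integrable_distr_eq[OF smP, of "\<lambda>x. (S x)\<^sup>2"] by (simp add: D)
  have V: "variance (\<lambda>\<omega>. S (sample X n \<omega>)) = NP.variance S"
    using Sm by (simp add: transfer[OF Sm] transfer[of "\<lambda>x. (S x - c)\<^sup>2" for c])
  have "jackknife (laws M X) n k S = jackknife N n k S" for k
    by (rule jackknife_cong_laws) (simp add: N_def I_def)
  then have J: "expectation (\<lambda>\<omega>. jackknife (laws M X) n k S (sample X n \<omega>)) = fact k * NP.level_sum I k S"
    if "k \<ge> 1" for k
    using NP.integral_jackknife[OF I_def that S] by (simp add: transfer)
  have sums: "(\<Sum>k=1..m. (-1)^(k+1) / fact k * expectation (\<lambda>\<omega>. jackknife (laws M X) n k S (sample X n \<omega>)))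
      = (\<Sum>k=1..m. (-1)^(k+1) * NP.level_sum I k S)" for m
    by (intro sum.cong refl) (simp add: J)
  show ?thesis
    unfolding sums V
  proof (intro conjI ballI)
    fix p assume "p \<in> {1..n div 2}"
    \<comment> \<open>The sign is positive for \<open>m = 2*p\<close> and negative for
      \<open>m = 2*p-1\<close>; \<open>p \<ge> 1\<close> makes the truncated difference odd.\<close>
    then show "(\<Sum>k=1..2*p. (-1)^(k+1) * NP.level_sum I k S) \<le> NP.variance S"
      and "NP.variance S \<le> (\<Sum>k=1..2*p-1. (-1)^(k+1) * NP.level_sum I k S)"
      using NP.variance_level_sums(1)[OF S, of "2*p"] NP.variance_level_sums(1)[OF S, of "2*p-1"] by simp_all
  next
    show "NP.variance S = (\<Sum>k=1..n. (-1)^(k+1) * NP.level_sum I k S)"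
      by (rule NP.variance_level_sums(2)[OF S]) (simp add: I_def)
  qed
qed

end
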